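(* Let $U\subseteq\mathbb{R}^m$ be a bounded open Lipschitz domain. Then the characteristic map $$\mathcal{E}:C^{0,1}(\overline U,\mathrm{Herm}(d))\to C^{0,\alpha}(\overline U,\mathbb{R}^d),\qquad A\mapsto\lambda^\uparrow\circ A,$$ is continuous, for all $0<\alpha<1$, but not for $\alpha=1$.
   Context: $M_d(\mathbb{C})$ is the space of complex $d\times d$ matrices with the Frobenius norm $\|A\|_2=(\sum_{i,j}|a_{ij}|^2)^{1/2}$, and $\mathrm{Herm}(d)=\{A\in M_d(\mathbb{C}):A^*=A\}$ is the real vector space of Hermitian matrices. The map $\lambda^{\uparrow}:\mathrm{Herm}(d)\to\mathbb{R}^d$ assigns to $A$ its eigenvalues (with multiplicity) in increasing order; it is Lipschitz with constant $1$ for the $2$-norms. For $\alpha\in(0,1]$ and a finite-dimensional real vector space $V$ with norm $\|\cdot\|_2$ (the Euclidean norm on $\mathbb{R}^d$, the Frobenius norm on $\mathrm{Herm}(d)$), $C^{0,\alpha}(\overline U,V)$ is the Banach space of continuous maps $f:U\to V$ that extend continuously to $\overline U$ and have finite norm $\|f\|_{C^{0,\alpha}}=\sup_{x\in U}\|f(x)\|_2+\sup_{x\ne y\in U}\frac{\|f(x)-f(y)\|_2}{\|x-y\|_2^\alpha}$. Both the source (with exponent $1$) and the target carry these norm topologies. A Lipschitz domain is an open set with Lipschitz boundary.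
   Formalization: The failure of continuity for α = 1 is stated for d ≥ 2 and nonempty U only; for d = 1 the characteristic map is the identity, and for empty U the spaces are single points, so it is continuous there. *)

theory Defs
  imports "HOL-Analysis.Analysis" "HOL-Computational_Algebra.Computational_Algebra"
begin

section \<open>Hermitian matrices and their ordered eigenvalues\<close>

text \<open>The norm of the type \<^typ>\<open>complex^'d^'d\<close> is the Frobenius norm, and the norm of
  \<^typ>\<open>real^'d\<close> is the Euclidean one.\<close>

definition conj_transpose :: "complex^'n^'m \<Rightarrow> complex^'m^'n" where
  "conj_transpose A = (\<chi> i j. cnj (A $ j $ i))"

definition Herm :: "(complex^'d^'d) set" where
  "Herm = {A. conj_transpose A = A}"

definition charpoly :: "complex^'d^'d \<Rightarrow> complex poly" where
  "charpoly A = det (\<chi> i j. (if i = j then [:0, 1:] else 0) - [:A $ i $ j:])"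

text \<open>The multiset of roots of the characteristic polynomial records the eigenvalues with
  multiplicity. For Hermitian matrices these are real, so \<^const>\<open>Re\<close> merely changes the type.\<close>

definition increasing_eigenvalues :: "complex^'d^'d \<Rightarrow> real list" where
  "increasing_eigenvalues A = sorted_list_of_multiset (image_mset Re (proots (charpoly A)))"

text \<open>The linear order on the index type identifies it with \<open>{0..<d}\<close>: the index \<open>i\<close> has position
  \<open>card {j. j < i}\<close>.\<close>

definition lambda_up :: "complex^('d::{finite,linorder})^('d::{finite,linorder}) \<Rightarrow> real^('d::{finite,linorder})" where
  "lambda_up A = (\<chi> i. increasing_eigenvalues A ! card {j. j < i})"

section \<open>Lipschitz domains\<close>

text \<open>Near each boundary point the open set is the strict epigraph of a Lipschitz function over a
  hyperplane: \<open>e\<close> is the unit normal of the hyperplane, and \<open>x - (x \<bullet> e) *\<^sub>R e\<close> is the orthogonal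
  projection of \<open>x\<close> to it.\<close>

definition lipschitz_domain :: "'a::euclidean_space set \<Rightarrow> bool" where
  "lipschitz_domain U \<longleftrightarrow> open U \<and>
     (\<forall>p\<in>frontier U. \<exists>e r L \<gamma>. norm e = 1 \<and> r > 0 \<and> L-lipschitz_on {y. y \<bullet> e = 0} \<gamma> \<and>
        U \<inter> ball p r = {x \<in> ball p r. \<gamma> (x - (x \<bullet> e) *\<^sub>R e) < x \<bullet> e})"

section \<open>Hoelder spaces\<close>

text \<open>The suprema are taken in \<open>[0,\<infinity>]\<close>, so that finiteness of the norm is a genuine condition and
  the supremum of the empty family is 0.\<close>

definition hoelder_norm ::
    "real \<Rightarrow> 'a::metric_space set \<Rightarrow> ('a \<Rightarrow> 'b::real_normed_vector) \<Rightarrow> ennreal" where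
  "hoelder_norm \<alpha> U f =
     (SUP x\<in>U. ennreal (norm (f x))) +
     (SUP (x, y)\<in>{(x, y). x \<in> U \<and> y \<in> U \<and> x \<noteq> y}.
        ennreal (norm (f x - f y) / dist x y powr \<alpha>))"

text \<open>Maps on \<open>U\<close> are represented by functions that are \<^const>\<open>undefined\<close> outside \<open>U\<close>.\<close>

definition hoelder_space ::
    "real \<Rightarrow> 'a::metric_space set \<Rightarrow> 'b::real_normed_vector set \<Rightarrow> ('a \<Rightarrow> 'b) set" where
  "hoelder_space \<alpha> U V =
     {f \<in> U \<rightarrow>\<^sub>E V.
        (\<exists>g. continuous_on (closure U) g \<and> g \<in> closure U \<rightarrow> V \<and> (\<forall>x\<in>U. g x = f x)) \<and>
        hoelder_norm \<alpha> U f < \<infinity>}"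

definition hoelder_dist ::
    "real \<Rightarrow> 'a::metric_space set \<Rightarrow> ('a \<Rightarrow> 'b::real_normed_vector) \<Rightarrow> ('a \<Rightarrow> 'b) \<Rightarrow> real" where
  "hoelder_dist \<alpha> U f g = enn2real (hoelder_norm \<alpha> U (\<lambda>x. f x - g x))"

definition hoelder_topology ::
    "real \<Rightarrow> 'a::metric_space set \<Rightarrow> 'b::real_normed_vector set \<Rightarrow> ('a \<Rightarrow> 'b) topology" where
  "hoelder_topology \<alpha> U V = Metric_space.mtopology (hoelder_space \<alpha> U V) (hoelder_dist \<alpha> U)"

lemma hoelder_norm_cong:
  assumes "\<And>x. x \<in> U \<Longrightarrow> norm (f x) = norm (g x)"
    and "\<And>x y. x \<in> U \<Longrightarrow> y \<in> U \<Longrightarrow> norm (f x - f y) = norm (g x - g y)"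
  shows "hoelder_norm \<alpha> U f = hoelder_norm \<alpha> U g"
  unfolding hoelder_norm_def using assms by (intro arg_cong2[where f="(+)"] SUP_cong) auto

lemma hoelder_norm_minus_commute:
  "hoelder_norm \<alpha> U (\<lambda>x. f x - g x) = hoelder_norm \<alpha> U (\<lambda>x. g x - f x)"
proof (rule hoelder_norm_cong)
  fix x y
  show "norm (f x - g x) = norm (g x - f x)" by (rule norm_minus_commute)
  have "f x - g x - (f y - g y) = - (g x - f x - (g y - f y))" by simp
  then show "norm (f x - g x - (f y - g y)) = norm (g x - f x - (g y - f y))"
    by (metis norm_minus_cancel)
qed

lemma hoelder_norm_triangle:
  "hoelder_norm \<alpha> U (\<lambda>x. f x + g x) \<le> hoelder_norm \<alpha> U f + hoelder_norm \<alpha> U g"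
proof -
  let ?P = "{(x, y). x \<in> U \<and> y \<in> U \<and> x \<noteq> y}"
  let ?q = "\<lambda>h (x, y). ennreal (norm (h x - h y) / dist x y powr \<alpha>)"
  have 1: "(SUP x\<in>U. ennreal (norm (f x + g x)))
      \<le> (SUP x\<in>U. ennreal (norm (f x))) + (SUP x\<in>U. ennreal (norm (g x)))"
  proof (rule SUP_least)
    fix x assume "x \<in> U"
    have "ennreal (norm (f x + g x)) \<le> ennreal (norm (f x)) + ennreal (norm (g x))"
      by (metis ennreal_leI ennreal_plus norm_ge_zero norm_triangle_ineq)
    also have "\<dots> \<le> (SUP x\<in>U. ennreal (norm (f x))) + (SUP x\<in>U. ennreal (norm (g x)))"
      using \<open>x \<in> U\<close> by (intro add_mono SUP_upper)
    finally show "ennreal (norm (f x + g x)) \<le> \<dots>" .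
  qed
  have 2: "(SUP p\<in>?P. ?q (\<lambda>x. f x + g x) p) \<le> (SUP p\<in>?P. ?q f p) + (SUP p\<in>?P. ?q g p)"
  proof (rule SUP_least)
    fix p assume p: "p \<in> ?P"
    obtain x y where xy: "p = (x, y)" by (cases p)
    have "f x + g x - (f y + g y) = (f x - f y) + (g x - g y)" by simp
    then have "norm (f x + g x - (f y + g y)) \<le> norm (f x - f y) + norm (g x - g y)"
      by (metis norm_triangle_ineq)
    then have "norm (f x + g x - (f y + g y)) / dist x y powr \<alpha>
        \<le> norm (f x - f y) / dist x y powr \<alpha> + norm (g x - g y) / dist x y powr \<alpha>"
      by (simp add: add_divide_distrib [symmetric] divide_right_mono)
    then have "?q (\<lambda>x. f x + g x) p \<le> ?q f p + ?q g p"
      by (simp add: xy ennreal_leI flip: ennreal_plus)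
    also have "\<dots> \<le> (SUP p\<in>?P. ?q f p) + (SUP p\<in>?P. ?q g p)"
      using p by (intro add_mono SUP_upper)
    finally show "?q (\<lambda>x. f x + g x) p \<le> \<dots>" .
  qed
  show ?thesis
    using add_mono[OF 1 2] unfolding hoelder_norm_def by (simp add: algebra_simps)
qed

lemma Metric_space_hoelder: "Metric_space (hoelder_space \<alpha> U V) (hoelder_dist \<alpha> U)"
proof -
  have fin: "hoelder_norm \<alpha> U (\<lambda>x. f x - g x) < \<infinity>"
    if "f \<in> hoelder_space \<alpha> U V" "g \<in> hoelder_space \<alpha> U V" for f g
  proof -
    have "hoelder_norm \<alpha> U (\<lambda>x. - g x) = hoelder_norm \<alpha> U g"
      by (rule hoelder_norm_cong) (auto simp: norm_minus_commute)
    then have "hoelder_norm \<alpha> U (\<lambda>x. f x - g x) \<le> hoelder_norm \<alpha> U f + hoelder_norm \<alpha> U g"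
      using hoelder_norm_triangle[of \<alpha> U f "\<lambda>x. - g x"] by simp
    also have "\<dots> < \<infinity>" using that by (auto simp: hoelder_space_def)
    finally show ?thesis .
  qed
  show ?thesis
  proof
    fix f g
    show "0 \<le> hoelder_dist \<alpha> U f g" by (simp add: hoelder_dist_def)
    show "hoelder_dist \<alpha> U f g = hoelder_dist \<alpha> U g f"
      unfolding hoelder_dist_def by (subst hoelder_norm_minus_commute) simp
  next
    fix f g assume fg: "f \<in> hoelder_space \<alpha> U V" "g \<in> hoelder_space \<alpha> U V"
    show "hoelder_dist \<alpha> U f g = 0 \<longleftrightarrow> f = g"
    proof
      assume "hoelder_dist \<alpha> U f g = 0"
      with fin[OF fg] have "hoelder_norm \<alpha> U (\<lambda>x. f x - g x) = 0"
        by (auto simp: hoelder_dist_def enn2real_eq_0_iff)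
      then have "(SUP x\<in>U. ennreal (norm (f x - g x))) = 0"
        by (simp add: hoelder_norm_def)
      then have "f x = g x" if "x \<in> U" for x
        using SUP_upper[OF that, of "\<lambda>x. ennreal (norm (f x - g x))"] by simp
      moreover have "f \<in> extensional U" "g \<in> extensional U"
        using fg by (auto simp: hoelder_space_def PiE_def)
      ultimately show "f = g" by (metis extensionalityI)
    qed (auto simp: hoelder_dist_def hoelder_norm_def bot_ennreal split_def SUP_constant)
  next
    fix f g h
    assume "f \<in> hoelder_space \<alpha> U V" "g \<in> hoelder_space \<alpha> U V" "h \<in> hoelder_space \<alpha> U V"
    then have "hoelder_norm \<alpha> U (\<lambda>x. f x - g x) + hoelder_norm \<alpha> U (\<lambda>x. g x - h x) < \<infinity>"
      using fin by simp
    moreover have "hoelder_norm \<alpha> U (\<lambda>x. f x - h x)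
        \<le> hoelder_norm \<alpha> U (\<lambda>x. f x - g x) + hoelder_norm \<alpha> U (\<lambda>x. g x - h x)"
      using hoelder_norm_triangle[of \<alpha> U "\<lambda>x. f x - g x" "\<lambda>x. g x - h x"] by simp
    ultimately show "hoelder_dist \<alpha> U f h \<le> hoelder_dist \<alpha> U f g + hoelder_dist \<alpha> U g h"
      unfolding hoelder_dist_def
      by (metis enn2real_mono enn2real_plus ennreal_add_less_top infinity_ennreal_def)
  qed
qed

lemma topspace_hoelder_topology [simp]: "topspace (hoelder_topology \<alpha> U V) = hoelder_space \<alpha> U V"
  by (simp add: hoelder_topology_def Metric_space.topspace_mtopology Metric_space_hoelder)

section \<open>The characteristic map\<close>

definition characteristic_map ::
    "'a set \<Rightarrow> ('a \<Rightarrow> complex^('d::{finite,linorder})^('d::{finite,linorder}))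
      \<Rightarrow> 'a \<Rightarrow> real^('d::{finite,linorder})" where
  "characteristic_map U A = restrict (lambda_up \<circ> A) U"

end

theory Submission
  imports Defs
begin

text \<open>By Weyl's inequality the ordered eigenvalues of a Hermitian matrix depend on it in a Lipschitz
  way. Hence the characteristic map sends a sequence that converges in the Lipschitz norm to one that
  converges uniformly and is bounded in the Lipschitz norm, and interpolation gives convergence for every
  Hoelder exponent below 1. For exponent 1, shifting an affine family of matrices by a small multiple of
  a fixed matrix moves the kink of an eigenvalue, and the difference of the eigenvalues before and after
  has Lipschitz seminorm at least 1, however small the shift.\<close>

text \<open>The space \<open>complex^'d\<close> is treated as a real Euclidean space of dimension 2
  * d, whose inner product is the real part of the Hermitian one: complex orthogonality to
  \<open>x\<close> is real orthogonality to \<open>x\<close> and to \<open>\<i> *s x\<close>. The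
  analysis uses nothing about eigenvalues beyond a Lipschitz bound, so the continuity half is proved
  for an arbitrary Lipschitz map \<Phi>. Interpolation raises the uniform distance to the power 1 -
  \<alpha>; this factor tends to 0 only for \<alpha> < 1, while at exponent 1 the seminorm of the
  difference is merely bounded.\<close>

no_notation fps_nth (infixl "$" 75)

section \<open>The spectral theorem for Hermitian matrices\<close>

lemma matrix_vector_mult_scaleR_complex:
  fixes A :: "complex^'n^'m"
  shows "A *v (c *\<^sub>R x) = c *\<^sub>R (A *v x)"
  by (simp add: vec_eq_iff matrix_vector_mult_def scaleR_sum_right)

text \<open>In the real inner product of the complex plane, multiplication by \<open>a\<close> has
  adjoint multiplication by \<open>cnj a\<close>. Hermitian matrices thus become self-adjoint real
  operators.\<close>

lemma inner_conj_transpose: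
  fixes A :: "complex^'n^'m"
  shows "(A *v x) \<bullet> y = x \<bullet> (conj_transpose A *v y)"
proof -
  have "(A *v x) \<bullet> y = (\<Sum>i\<in>UNIV. \<Sum>j\<in>UNIV. (A $ i $ j * x $ j) \<bullet> y $ i)"
    by (simp add: inner_vec_def matrix_vector_mult_def inner_sum_left)
  also have "\<dots> = (\<Sum>i\<in>UNIV. \<Sum>j\<in>UNIV. x $ j \<bullet> (cnj (A $ i $ j) * y $ i))"
    by (intro sum.cong refl) (simp add: inner_complex_def algebra_simps)
  also have "\<dots> = x \<bullet> (conj_transpose A *v y)"
    by (subst sum.swap)
      (simp add: inner_vec_def matrix_vector_mult_def inner_sum_right conj_transpose_def)
  finally show ?thesis .
qed

text \<open>Cauchy-Schwarz in each row; the Euclidean norm of the row norms is the Frobenius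
  norm.\<close>

lemma norm_matrix_vector_mult_le:
  fixes A :: "complex^'n^'m"
  shows "norm (A *v x) \<le> norm A * norm x"
proof -
  have row: "norm ((A *v x) $ i) \<le> norm (A $ i) * norm x" for i
  proof -
    have "norm ((A *v x) $ i) \<le> (\<Sum>j\<in>UNIV. norm (A $ i $ j) * norm (x $ j))"
      by (simp add: matrix_vector_mult_def sum_norm_le norm_mult)
    also have "\<dots> \<le> norm (A $ i) * norm x"
      using L2_set_mult_ineq[of "\<lambda>j. norm (A $ i $ j)" "\<lambda>j. norm (x $ j)" UNIV]
      by (simp add: norm_vec_def)
    finally show ?thesis .
  qed
  have "norm (A *v x) \<le> L2_set (\<lambda>i. norm x * norm (A $ i)) UNIV"
    unfolding norm_vec_def[of "A *v x"] by (rule L2_set_mono) (use row in \<open>auto simp: mult.commute\<close>)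
  also have "\<dots> = norm x * norm A"
    by (simp add: norm_vec_def[of A] L2_set_right_distrib)
  finally show ?thesis by (simp add: mult.commute)
qed

text \<open>The Hermitian product has real part \<open>x \<bullet> y\<close> and imaginary part
  \<open>(\<i> *s x) \<bullet> y\<close>.\<close>

lemma cinner_eq_0_iff:
  fixes x y :: "complex^'n"
  shows "(\<Sum>r\<in>UNIV. cnj (x $ r) * y $ r) = 0 \<longleftrightarrow> x \<bullet> y = 0 \<and> (\<i> *s x) \<bullet> y = 0"
  by (simp add: complex_eq_iff inner_vec_def inner_complex_def algebra_simps sum_subtractf)

lemma cinner_self:
  fixes x :: "complex^'n"
  shows "(\<Sum>r\<in>UNIV. cnj (x $ r) * x $ r) = complex_of_real (x \<bullet> x)"
  by (simp add: complex_eq_iff inner_vec_def inner_complex_def algebra_simps sum_subtractf)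

text \<open>Every complex vector imposes two real conditions, and the real dimension is twice
  \<open>CARD('n)\<close>. There are two families because Weyl's inequality combines eigenvectors of
  two matrices.\<close>

lemma complement_nontrivial:
  fixes f g :: "'i \<Rightarrow> complex^'n"
  assumes "finite I" "finite J" "card I + card J < CARD('n)"
  obtains v where "v \<noteq> 0"
    "\<And>i. i \<in> I \<Longrightarrow> f i \<bullet> v = 0" "\<And>i. i \<in> I \<Longrightarrow> (\<i> *s f i) \<bullet> v = 0"
    "\<And>i. i \<in> J \<Longrightarrow> g i \<bullet> v = 0" "\<And>i. i \<in> J \<Longrightarrow> (\<i> *s g i) \<bullet> v = 0"
proof -
  define S where
    "S = (f ` I \<union> (\<lambda>i. \<i> *s f i) ` I) \<union> (g ` J \<union> (\<lambda>i. \<i> *s g i) ` J)"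
  have "finite S" using assms by (simp add: S_def)
  have "dim S \<le> card S"
    by (rule dim_le_card[OF span_superset \<open>finite S\<close>])
  also have "card S \<le> (card I + card I) + (card J + card J)"
    unfolding S_def
    by (intro order.trans[OF card_Un_le] add_mono card_image_le assms)
  also have "\<dots> < DIM(complex^'n)" using assms(3) by simp
  finally obtain v where "v \<noteq> 0" and v: "\<And>y. y \<in> span S \<Longrightarrow> orthogonal v y"
    using orthogonal_to_subspace_exists by blast
  have "y \<bullet> v = 0" if "y \<in> S" for y
    using v[OF span_base[OF that]] by (simp add: orthogonal_def inner_commute)
  with \<open>v \<noteq> 0\<close> show thesis by (intro that) (auto simp: S_def)
qed

text \<open>A maximiser of the Rayleigh quotient on an invariant subspace is an eigenvector, because the
  gradient of the quotient lies in the subspace and vanishes there.\<close>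

lemma self_adjoint_eigenvector_exists:
  fixes T :: "'a::euclidean_space \<Rightarrow> 'a"
  assumes "linear T" and sa: "\<And>x y. T x \<bullet> y = x \<bullet> T y"
    and W: "subspace W" "\<And>w. w \<in> W \<Longrightarrow> T w \<in> W" and "u \<in> W" "u \<noteq> 0"
  obtains v where "v \<in> W" "norm v = 1" "T v = (v \<bullet> T v) *\<^sub>R v"
proof -
  interpret linear T by fact
  have "compact (W \<inter> sphere 0 1)"
    using closed_subspace[OF W(1)] by (simp add: closed_Int_compact)
  moreover have "u /\<^sub>R norm u \<in> W \<inter> sphere 0 1"
    using assms by (auto intro: subspace_scale)
  moreover have "continuous_on (W \<inter> sphere 0 1) (\<lambda>w. w \<bullet> T w)"
    using assms by (intro continuous_intros linear_continuous_on) (simp add: linear_linear)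
  ultimately obtain v where v: "v \<in> W" "norm v = 1"
    and max: "\<And>w. w \<in> W \<Longrightarrow> norm w = 1 \<Longrightarrow> w \<bullet> T w \<le> v \<bullet> T v"
    using continuous_attains_sup[of "W \<inter> sphere 0 1" "\<lambda>w. w \<bullet> T w"] that by fastforce
  define m where "m = v \<bullet> T v"
  have vv: "v \<bullet> v = 1" using v by (simp add: dot_square_norm)
  have bound: "w \<bullet> T w \<le> m * (w \<bullet> w)" if "w \<in> W" for w
  proof (cases "w = 0")
    case False
    have "(w /\<^sub>R norm w) \<bullet> T (w /\<^sub>R norm w) \<le> m"
      unfolding m_def using that False W(1) by (intro max) (auto intro: subspace_scale)
    then have "(w \<bullet> T w) / (norm w)\<^sup>2 \<le> m"
      by (simp add: scale power2_eq_square divide_simps)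
    with False show ?thesis
      by (simp add: dot_square_norm field_simps)
  qed (simp add: zero)
  \<comment> \<open>\<open>r\<close> is half the gradient at \<open>v\<close> of m * (w \<bullet> w)
    - w \<bullet> T w, a form that is nonnegative on \<open>W\<close> and zero at \<open>v\<close>;
    a short step from \<open>v\<close> against \<open>r\<close> would make it negative unless
    \<open>r\<close> is 0.\<close>
  define r where "r = m *\<^sub>R v - T v"
  have "r \<in> W" 
    unfolding r_def by (intro subspace_diff subspace_scale W v)
  have "T v = m *\<^sub>R v - r" by (simp add: r_def)
  then have vr: "v \<bullet> T r = m * (v \<bullet> r) - r \<bullet> r"
    using sa[of v r] by (simp add: inner_diff_left)
  have "r \<bullet> r = 0"
  proof (rule ccontr)
    assume "r \<bullet> r \<noteq> 0"
    then have pos: "r \<bullet> r > 0" by (simp add: order_less_le)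
    define q where "q = m * (r \<bullet> r) - r \<bullet> T r"
    have ineq: "0 \<le> 2 * t * (r \<bullet> r) + t\<^sup>2 * q" for t
    proof -
      have "(v + t *\<^sub>R r) \<in> W" by (intro subspace_add subspace_scale W v \<open>r \<in> W\<close>)
      from bound[OF this] have "0 \<le> m * ((v + t *\<^sub>R r) \<bullet> (v + t *\<^sub>R r))
          - (v + t *\<^sub>R r) \<bullet> T (v + t *\<^sub>R r)" by simp
      also have "\<dots> = m * (v \<bullet> v) - v \<bullet> T v + 2 * t * (m * (v \<bullet> r) - v \<bullet> T r) + t\<^sup>2 * q"
        using sa[of v r]
        by (simp add: add scale inner_add q_def algebra_simps power2_eq_square inner_commute)
      also have "\<dots> = 2 * t * (r \<bullet> r) + t\<^sup>2 * q"
        by (simp add: vr vv m_def)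
      finally show ?thesis .
    qed
    \<comment> \<open>After a step of -t the linear term is -2 * t * (r \<bullet> r); this
      \<open>t\<close> keeps the quadratic term at most half that size.\<close>
    define t where "t = (r \<bullet> r) / (\<bar>q\<bar> + 1)"
    have t: "t > 0" using pos by (simp add: t_def)
    have "0 \<le> t * (t * q - 2 * (r \<bullet> r))" using ineq[of "-t"] by (simp add: power2_eq_square algebra_simps)
    then have "2 * (r \<bullet> r) \<le> t * q" using t by (simp add: zero_le_mult_iff)
    also have "\<dots> \<le> t * (\<bar>q\<bar> + 1)" using t by (intro mult_left_mono) auto
    also have "\<dots> = r \<bullet> r" by (simp add: t_def add_pos_nonneg)
    finally show False using pos by simp
  qed
  then have "T v = (v \<bullet> T v) *\<^sub>R v" by (simp add: r_def m_def)
  with v that show thesis by blast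
qed

text \<open>Induction on the set of indices: the complex orthogonal complement of the eigenvectors
  found so far is nonzero and invariant, so it contains a further one.\<close>

lemma orthonormal_eigenvectors_exist:
  fixes A :: "complex^'d^'d"
  assumes A: "A \<in> Herm"
  obtains f :: "'d \<Rightarrow> complex^'d" and \<mu> :: "'d \<Rightarrow> real"
  where "\<And>i. A *v f i = \<mu> i *\<^sub>R f i"
    and "\<And>i j. (\<Sum>r\<in>UNIV. cnj (f i $ r) * f j $ r) = (if i = j then 1 else 0)"
proof -
  let ?c = "\<lambda>x y :: complex^'d. (\<Sum>r\<in>UNIV. cnj (x $ r) * y $ r)"
  have sa: "(A *v x) \<bullet> y = x \<bullet> (A *v y)" for x y
    using A inner_conj_transpose[of A x y] by (simp add: Herm_def)
  have "\<exists>f \<mu>. (\<forall>i\<in>I. A *v f i = \<mu> i *\<^sub>R f i) \<and> (\<forall>i\<in>I. \<forall>j\<in>I. ?c (f i) (f j) = (if i = j then 1 else 0))"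
    for I :: "'d set"
    using finite[of I]
  proof (induction I)
    case (insert k I)
    then obtain f \<mu> where eig: "\<forall>i\<in>I. A *v f i = \<mu> i *\<^sub>R f i"
      and on: "\<forall>i\<in>I. \<forall>j\<in>I. ?c (f i) (f j) = (if i = j then 1 else 0)" by blast
    define W where "W = {w. \<forall>i\<in>I. f i \<bullet> w = 0 \<and> (\<i> *s f i) \<bullet> w = 0}"
    have "card I < CARD('d)"
      using insert.hyps by (intro psubset_card_mono) auto
    then obtain u where "u \<noteq> 0" "\<And>i. i \<in> I \<Longrightarrow> f i \<bullet> u = 0"
      "\<And>i. i \<in> I \<Longrightarrow> (\<i> *s f i) \<bullet> u = 0"
      using complement_nontrivial[of I "{}" f f] insert.hyps by (metis add_0_right card.empty finite.emptyI)
    then have u: "u \<noteq> 0" "u \<in> W" by (auto simp: W_def)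
    have "subspace W"
      by (auto simp: W_def subspace_def inner_add_right)
    moreover have "A *v w \<in> W" if w: "w \<in> W" for w
    proof -
      have "f i \<bullet> (A *v w) = 0 \<and> (\<i> *s f i) \<bullet> (A *v w) = 0" if "i \<in> I" for i
      proof -
        \<comment> \<open>Since \<i> times an eigenvector has the same eigenvalue, self-adjointness
          preserves both real conditions that define \<open>W\<close>.\<close>
        have "A *v (\<i> *s f i) = \<mu> i *\<^sub>R (\<i> *s f i)"
          using eig that by (simp add: vector_scalar_commute vec_eq_iff)
        then show ?thesis
          using eig w that by (simp add: W_def flip: sa)
      qed
      then show ?thesis by (simp add: W_def)
    qed
    moreover have "linear ((*v) A)"
      by (auto intro!: linearI simp: matrix_vector_right_distrib matrix_vector_mult_scaleR_complex)
    ultimately obtain v where v: "v \<in> W" "norm v = 1" "A *v v = (v \<bullet> (A *v v)) *\<^sub>R v"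
      using self_adjoint_eigenvector_exists[of "(*v) A" W u] sa u by blast
    define f' where "f' = f(k := v)"
    define \<mu>' where "\<mu>' = \<mu>(k := v \<bullet> (A *v v))"
    have fv: "?c (f i) v = 0" if "i \<in> I" for i
      using v(1) that by (simp add: W_def cinner_eq_0_iff)
    have vf: "?c v (f i) = 0" if "i \<in> I" for i
    proof -
      have "?c v (f i) = cnj (?c (f i) v)" by (simp add: mult.commute)
      then show ?thesis using fv[OF that] by simp
    qed
    have vv: "?c v v = 1"
      using v(2) by (simp add: cinner_self dot_square_norm)
    have "\<forall>i\<in>insert k I. A *v f' i = \<mu>' i *\<^sub>R f' i"
      using eig v(3) by (auto simp: f'_def \<mu>'_def)
    moreover have "?c (f' i) (f' j) = (if i = j then 1 else 0)"
      if "i \<in> insert k I" "j \<in> insert k I" for i j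
      using that on insert.hyps fv vf vv by (auto simp: f'_def simp del: cnj_sum)
    ultimately show ?case by blast
  qed auto
  from this[of UNIV] that show thesis by auto
qed

section \<open>Eigenvalues and Weyl's inequality\<close>

lemma proots_prod_linear_factors:
  fixes c :: "'i \<Rightarrow> 'a::idom"
  assumes "finite I"
  shows "proots (\<Prod>i\<in>I. [:- c i, 1:]) = image_mset c (mset_set I)"
  using assms by (induction I) (auto simp: proots_mult simp del: mult_pCons_left)

lemma charpoly_diagonal:
  fixes D :: "complex^'d^'d"
  assumes "\<And>i j. i \<noteq> j \<Longrightarrow> D $ i $ j = 0"
  shows "charpoly D = (\<Prod>i\<in>UNIV. [:- D $ i $ i, 1:])"
  unfolding charpoly_def by (subst det_diagonal) (auto simp: assms)

text \<open>Embedding scalars as constant polynomials is multiplicative, so the similarity carries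
  over to X - A and X - B. Taking determinants, the nonzero factor \<open>det (C P)\<close> cancels
  in the integral domain of polynomials.\<close>

lemma charpoly_similar:
  fixes A B P Q :: "complex^'d^'d"
  assumes "Q ** P = mat 1" and "A ** P = P ** B"
  shows "charpoly A = charpoly B"
proof -
  define C :: "complex^'d^'d \<Rightarrow> complex poly^'d^'d" where "C M = (\<chi> i j. [:M $ i $ j:])" for M
  have C_mult: "C (M ** N) = C M ** C N" for M N
    by (simp add: C_def vec_eq_iff matrix_matrix_mult_def poly_eq_iff coeff_sum coeff_pCons mult.commute
        split: nat.split)
  have C_1: "C (mat 1) = mat 1"
    by (simp add: C_def vec_eq_iff mat_def one_pCons)
  have cp: "charpoly M = det (mat [:0, 1:] - C M)" for M
    unfolding charpoly_def by (rule arg_cong[of _ _ det]) (simp add: C_def vec_eq_iff mat_def)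
  have "(mat [:0, 1:] - C A) ** C P = C P ** (mat [:0, 1:] - C B)"
  proof -
    have "mat x ** M = M ** mat x" for M :: "complex poly^'d^'d" and x
      by (simp add: vec_eq_iff matrix_matrix_mult_def mat_def if_distrib if_distribR mult.commute cong: if_cong)
    moreover have "(M - N) ** K = M ** K - N ** K" "K ** (M - N) = K ** M - K ** N"
      for M N K :: "complex poly^'d^'d"
      by (simp_all add: vec_eq_iff matrix_matrix_mult_def algebra_simps sum_subtractf)
    ultimately show ?thesis by (metis C_mult assms(2))
  qed
  then have "charpoly A * det (C P) = det (C P) * charpoly B"
    by (simp add: cp flip: det_mul)
  moreover have "det (C Q) * det (C P) = 1"
    by (simp add: C_1 assms flip: det_mul C_mult)
  then have "det (C P) \<noteq> 0" by auto
  ultimately show ?thesis by simp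
qed

lemma conj_transpose_mult_eq_mat_1_iff:
  fixes f :: "'d \<Rightarrow> complex^'d"
  defines "P \<equiv> \<chi> r i. f i $ r"
  shows "conj_transpose P ** P = mat 1 \<longleftrightarrow>
    (\<forall>i j. (\<Sum>r\<in>UNIV. cnj (f i $ r) * f j $ r) = (if i = j then 1 else 0))"
  by (simp add: P_def vec_eq_iff matrix_matrix_mult_def conj_transpose_def mat_def)

text \<open>The last two clauses are the two halves of the Courant--Fischer principle.\<close>

lemma hermitian_eigenvalues:
  fixes A :: "complex^'d^'d"
  assumes "A \<in> Herm"
  obtains f :: "'d \<Rightarrow> complex^'d" and \<mu> :: "'d \<Rightarrow> real"
  where "increasing_eigenvalues A = sorted_list_of_multiset (image_mset \<mu> (mset_set UNIV))"
    and "\<And>a v. (\<And>i. \<mu> i > a \<Longrightarrow> f i \<bullet> v = 0 \<and> (\<i> *s f i) \<bullet> v = 0) \<Longrightarrow> v \<bullet> (A *v v) \<le> a * (v \<bullet> v)"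
    and "\<And>a v. (\<And>i. \<mu> i < a \<Longrightarrow> f i \<bullet> v = 0 \<and> (\<i> *s f i) \<bullet> v = 0) \<Longrightarrow> v \<bullet> (A *v v) \<ge> a * (v \<bullet> v)"
proof -
  obtain f :: "'d \<Rightarrow> complex^'d" and \<mu> where eig: "\<And>i. A *v f i = \<mu> i *\<^sub>R f i"
    and on: "\<And>i j. (\<Sum>r\<in>UNIV. cnj (f i $ r) * f j $ r) = (if i = j then 1 else 0)"
    using orthonormal_eigenvectors_exist[OF assms] by blast
  define P :: "complex^'d^'d" where "P = (\<chi> r i. f i $ r)"
  define D :: "complex^'d^'d" where "D = (\<chi> i j. if i = j then complex_of_real (\<mu> i) else 0)"
  have PP: "conj_transpose P ** P = mat 1"
    unfolding P_def conj_transpose_mult_eq_mat_1_iff using on by blast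
  then have PP': "P ** conj_transpose P = mat 1"
    by (simp add: matrix_left_right_inverse)
  have "A ** P = P ** D"
  proof -
    have "(A ** P) $ r $ i = (A *v f i) $ r" for r i
      by (simp add: P_def matrix_matrix_mult_def matrix_vector_mult_def)
    moreover have "(P ** D) $ r $ i = \<mu> i *\<^sub>R f i $ r" for r i
      by (simp add: P_def D_def matrix_matrix_mult_def scaleR_conv_of_real mult.commute
          if_distrib if_distribR cong: if_cong)
    ultimately show ?thesis by (simp add: vec_eq_iff eig)
  qed
  have "charpoly A = charpoly D"
    using charpoly_similar PP \<open>A ** P = P ** D\<close> by blast
  also have "\<dots> = (\<Prod>i\<in>UNIV. [:- complex_of_real (\<mu> i), 1:])"
    by (subst charpoly_diagonal) (auto simp: D_def)
  finally have "proots (charpoly A) = image_mset (\<lambda>i. complex_of_real (\<mu> i)) (mset_set UNIV)"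
    by (simp add: proots_prod_linear_factors)
  then have ev: "increasing_eigenvalues A = sorted_list_of_multiset (image_mset \<mu> (mset_set UNIV))"
    by (simp add: increasing_eigenvalues_def image_mset.compositionality comp_def)
  \<comment> \<open>\<open>w\<close> lists the coordinates of \<open>v\<close> in the eigenbasis,
    where the quadratic form is diagonal.\<close>
  have expand: "v \<bullet> (A *v v) = (\<Sum>i\<in>UNIV. \<mu> i * (norm (w $ i))\<^sup>2)"
    "v \<bullet> v = (\<Sum>i\<in>UNIV. (norm (w $ i))\<^sup>2)"
    if w: "w = conj_transpose P *v v" for v w
  proof -
    have v: "v = P *v w" by (simp add: w matrix_vector_mul_assoc PP')
    have iso: "(P *v x) \<bullet> (P *v y) = x \<bullet> y" for x y
      by (simp add: inner_conj_transpose matrix_vector_mul_assoc PP)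
    show "v \<bullet> v = (\<Sum>i\<in>UNIV. (norm (w $ i))\<^sup>2)"
      by (simp add: v iso) (simp add: inner_vec_def dot_square_norm)
    have "A *v v = P *v (D *v w)"
      by (simp add: v matrix_vector_mul_assoc \<open>A ** P = P ** D\<close>)
    then have "v \<bullet> (A *v v) = w \<bullet> (D *v w)"
      by (simp add: v iso)
    also have "D *v w = (\<chi> i. \<mu> i *\<^sub>R w $ i)"
      by (simp add: D_def vec_eq_iff matrix_vector_mult_def scaleR_conv_of_real
          if_distrib if_distribR cong: if_cong)
    also have "w \<bullet> \<dots> = (\<Sum>i\<in>UNIV. \<mu> i * (norm (w $ i))\<^sup>2)"
      by (simp add: inner_vec_def dot_square_norm)
    finally show "v \<bullet> (A *v v) = (\<Sum>i\<in>UNIV. \<mu> i * (norm (w $ i))\<^sup>2)" .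
  qed
  \<comment> \<open>The orthogonality hypotheses thus kill the coordinates whose eigenvalues lie on
    the wrong side of \<open>a\<close>; the other terms are compared one by one.\<close>
  have zero: "(conj_transpose P *v v) $ i = 0 \<longleftrightarrow> f i \<bullet> v = 0 \<and> (\<i> *s f i) \<bullet> v = 0" for i v
    unfolding cinner_eq_0_iff[symmetric]
    by (simp add: P_def conj_transpose_def matrix_vector_mult_def)
  show thesis
  proof (rule that[OF ev])
    fix a v
    assume *: "\<And>i. \<mu> i > a \<Longrightarrow> f i \<bullet> v = 0 \<and> (\<i> *s f i) \<bullet> v = 0"
    have "(\<Sum>i\<in>UNIV. \<mu> i * (norm ((conj_transpose P *v v) $ i))\<^sup>2)
        \<le> (\<Sum>i\<in>UNIV. a * (norm ((conj_transpose P *v v) $ i))\<^sup>2)"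
    proof (rule sum_mono)
      fix i
      show "\<mu> i * (norm ((conj_transpose P *v v) $ i))\<^sup>2 \<le> a * (norm ((conj_transpose P *v v) $ i))\<^sup>2"
        using *[of i] zero[of v i] by (cases "\<mu> i > a") (auto intro: mult_right_mono)
    qed
    then show "v \<bullet> (A *v v) \<le> a * (v \<bullet> v)"
      by (simp add: expand sum_distrib_left)
  next
    fix a v
    assume *: "\<And>i. \<mu> i < a \<Longrightarrow> f i \<bullet> v = 0 \<and> (\<i> *s f i) \<bullet> v = 0"
    have "(\<Sum>i\<in>UNIV. a * (norm ((conj_transpose P *v v) $ i))\<^sup>2)
        \<le> (\<Sum>i\<in>UNIV. \<mu> i * (norm ((conj_transpose P *v v) $ i))\<^sup>2)"
    proof (rule sum_mono)
      fix i
      show "a * (norm ((conj_transpose P *v v) $ i))\<^sup>2 \<le> \<mu> i * (norm ((conj_transpose P *v v) $ i))\<^sup>2"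
        using *[of i] zero[of v i] by (cases "\<mu> i < a") (auto intro: mult_right_mono)
    qed
    then show "v \<bullet> (A *v v) \<ge> a * (v \<bullet> v)"
      by (simp add: expand sum_distrib_left)
  qed
qed

text \<open>Sorting preserves the multiset, so indices can be counted as list positions: strictly
  larger entries sit after position \<open>k\<close>, strictly smaller ones before it. Ties turn the
  counts into inequalities.\<close>

lemma card_le_nth_sorted:
  fixes \<mu> :: "'i \<Rightarrow> 'a::linorder"
  assumes "finite I" "k < card I"
  defines "xs \<equiv> sorted_list_of_multiset (image_mset \<mu> (mset_set I))"
  shows "card {i\<in>I. \<mu> i > xs ! k} \<le> card I - Suc k" and "card {i\<in>I. \<mu> i < xs ! k} \<le> k"
proof -
  have mset: "mset xs = image_mset \<mu> (mset_set I)" and sorted: "sorted xs"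
    by (simp_all add: xs_def)
  have len: "length xs = card I"
    using arg_cong[OF mset, of size] by simp
  have count: "card {i\<in>I. Q (\<mu> i)} = card {j. j < length xs \<and> Q (xs ! j)}" for Q
  proof -
    have "card {i\<in>I. Q (\<mu> i)} = size (filter_mset Q (image_mset \<mu> (mset_set I)))"
      using assms(1) by (simp add: filter_mset_image_mset filter_mset_mset_set)
    also have "\<dots> = length (filter Q xs)"
      by (metis mset mset_filter size_mset)
    finally show ?thesis by (simp add: length_filter_conv_card)
  qed
  have "j \<in> {Suc k..<card I}" if "j < length xs" "xs ! j > xs ! k" for j
    using that sorted_nth_mono[OF sorted, of j k] assms(2) by (force simp: len not_less_eq_eq)
  then have "card {j. j < length xs \<and> xs ! j > xs ! k} \<le> card {Suc k..<card I}"
    by (intro card_mono) auto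
  then show "card {i\<in>I. \<mu> i > xs ! k} \<le> card I - Suc k"
    by (simp add: count[of "\<lambda>x. x > xs ! k"])
  have "j \<in> {..<k}" if "j < length xs" "xs ! j < xs ! k" for j
    using that sorted_nth_mono[OF sorted, of k j] by (force simp: not_less)
  then have "card {j. j < length xs \<and> xs ! j < xs ! k} \<le> card {..<k}"
    by (intro card_mono) auto
  then show "card {i\<in>I. \<mu> i < xs ! k} \<le> k"
    by (simp add: count[of "\<lambda>x. x < xs ! k"])
qed

text \<open>If the gap exceeded the norm, the eigenvectors of \<open>A\<close> above its k-th
  eigenvalue and those of \<open>B\<close> below its k-th would leave a common nonzero orthogonal
  vector. On it the two quadratic forms differ by at least the gap and by at most the norm, each
  times the squared length.\<close>

lemma weyl_inequality:
  fixes A B :: "complex^'d^'d"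
  assumes "A \<in> Herm" "B \<in> Herm" and k: "k < CARD('d)"
  shows "increasing_eigenvalues B ! k \<le> increasing_eigenvalues A ! k + norm (B - A)"
proof (rule ccontr)
  let ?a = "increasing_eigenvalues A ! k" and ?b = "increasing_eigenvalues B ! k"
  assume "\<not> ?b \<le> ?a + norm (B - A)"
  then have less: "norm (B - A) < ?b - ?a" by simp
  obtain f :: "'d \<Rightarrow> complex^'d" and \<mu>
    where A: "increasing_eigenvalues A = sorted_list_of_multiset (image_mset \<mu> (mset_set UNIV))"
    and fle: "\<And>a v. (\<And>i. \<mu> i > a \<Longrightarrow> f i \<bullet> v = 0 \<and> (\<i> *s f i) \<bullet> v = 0) \<Longrightarrow> v \<bullet> (A *v v) \<le> a * (v \<bullet> v)"
    using hermitian_eigenvalues[OF assms(1)] by metis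
  obtain g :: "'d \<Rightarrow> complex^'d" and \<nu>
    where B: "increasing_eigenvalues B = sorted_list_of_multiset (image_mset \<nu> (mset_set UNIV))"
    and gge: "\<And>a v. (\<And>i. \<nu> i < a \<Longrightarrow> g i \<bullet> v = 0 \<and> (\<i> *s g i) \<bullet> v = 0) \<Longrightarrow> v \<bullet> (B *v v) \<ge> a * (v \<bullet> v)"
    using hermitian_eigenvalues[OF assms(2)] by metis
  have "card {i. \<mu> i > ?a} \<le> CARD('d) - Suc k"
    using card_le_nth_sorted(1)[of "UNIV :: 'd set" k \<mu>] k by (simp add: A)
  moreover have "card {i. \<nu> i < ?b} \<le> k"
    using card_le_nth_sorted(2)[of "UNIV :: 'd set" k \<nu>] k by (simp add: B)
  \<comment> \<open>The bounds d - (k + 1) and k add up to d - 1, which leaves one complex dimension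
    free.\<close>
  ultimately have "card {i. \<mu> i > ?a} + card {i. \<nu> i < ?b} < CARD('d)"
    using k by linarith
  then obtain v where "v \<noteq> 0"
    and v: "\<And>i. i \<in> {i. \<mu> i > ?a} \<Longrightarrow> f i \<bullet> v = 0" "\<And>i. i \<in> {i. \<mu> i > ?a} \<Longrightarrow> (\<i> *s f i) \<bullet> v = 0"
      "\<And>i. i \<in> {i. \<nu> i < ?b} \<Longrightarrow> g i \<bullet> v = 0" "\<And>i. i \<in> {i. \<nu> i < ?b} \<Longrightarrow> (\<i> *s g i) \<bullet> v = 0"
    using complement_nontrivial[of "{i. \<mu> i > ?a}" "{i. \<nu> i < ?b}" f g] by (metis finite)
  have "(?b - ?a) * (v \<bullet> v) \<le> v \<bullet> (B *v v) - v \<bullet> (A *v v)"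
    using fle[of ?a v] gge[of ?b v] v by (simp add: algebra_simps)
  also have "\<dots> = v \<bullet> ((B - A) *v v)"
    by (simp add: matrix_vector_mult_diff_rdistrib inner_diff_right)
  also have "\<dots> \<le> norm v * (norm (B - A) * norm v)"
    by (rule order.trans[OF norm_cauchy_schwarz mult_left_mono[OF norm_matrix_vector_mult_le]]) simp
  also have "\<dots> = norm (B - A) * (v \<bullet> v)"
    by (simp add: dot_square_norm power2_eq_square)
  finally show False using less \<open>v \<noteq> 0\<close> by simp
qed

text \<open>Weyl bounds each coordinate; passing through the l1 norm costs the factor
  \<open>CARD('d)\<close>.\<close>

lemma lambda_up_lipschitz:
  fixes A B :: "complex^('d::{finite,linorder})^('d::{finite,linorder})"
  assumes "A \<in> Herm" "B \<in> Herm"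
  shows "norm (lambda_up A - lambda_up B) \<le> CARD('d) * norm (A - B)"
proof -
  have "\<bar>(lambda_up A - lambda_up B) $ i\<bar> \<le> norm (A - B)" for i
  proof -
    \<comment> \<open>The index \<open>i\<close> does not count itself, so its position is a valid
      one.\<close>
    have "card {j. j < i} < CARD('d)" by (intro psubset_card_mono) auto
    from weyl_inequality[OF assms this] weyl_inequality[OF assms(2,1) this] show ?thesis
      by (simp add: lambda_up_def norm_minus_commute abs_le_iff algebra_simps)
  qed
  then have "(\<Sum>i\<in>UNIV. \<bar>(lambda_up A - lambda_up B) $ i\<bar>) \<le> CARD('d) * norm (A - B)"
    by (intro sum_bounded_above) 
  with norm_le_l1_cart[of "lambda_up A - lambda_up B"] show ?thesis by linarith
qed

section \<open>Estimates in Hoelder spaces\<close>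

text \<open>Split t as \<open>t powr (1 - \<alpha>) * t powr \<alpha>\<close> and bound each factor.
  In the applications \<open>a\<close> is a uniform bound and \<open>b\<close> a multiple of the
  distance of two points.\<close>

lemma interpolate_powr:
  fixes t :: real
  assumes "0 \<le> t" "t \<le> a" "t \<le> b" "0 < a" "0 \<le> \<alpha>" "\<alpha> \<le> 1"
  shows "t \<le> a powr (1 - \<alpha>) * b powr \<alpha>"
proof (cases "t = 0")
  case False
  then have "t = t powr (1 - \<alpha>) * t powr \<alpha>"
    using assms by (simp flip: powr_add)
  also have "\<dots> \<le> a powr (1 - \<alpha>) * b powr \<alpha>"
    using assms by (intro mult_mono powr_mono2) auto
  finally show ?thesis .
qed simp

lemma hoelder_norm_le:
  fixes f :: "'a::metric_space \<Rightarrow> 'b::real_normed_vector"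
  assumes "0 \<le> M" "0 \<le> K"
    and "\<And>x. x \<in> U \<Longrightarrow> norm (f x) \<le> M"
    and "\<And>x y. x \<in> U \<Longrightarrow> y \<in> U \<Longrightarrow> x \<noteq> y \<Longrightarrow> norm (f x - f y) \<le> K * dist x y powr \<alpha>"
  shows "hoelder_norm \<alpha> U f \<le> ennreal (M + K)"
proof -
  have "(SUP x\<in>U. ennreal (norm (f x))) \<le> ennreal M"
    using assms(3) by (intro SUP_least ennreal_leI)
  moreover have "(SUP (x, y)\<in>{(x, y). x \<in> U \<and> y \<in> U \<and> x \<noteq> y}.
        ennreal (norm (f x - f y) / dist x y powr \<alpha>)) \<le> ennreal K"
    using assms(4) by (intro SUP_least) (auto intro!: ennreal_leI simp: divide_le_eq)
  ultimately show ?thesis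
    unfolding hoelder_norm_def using assms(1,2) by (simp add: add_mono ennreal_plus)
qed

text \<open>Finiteness is assumed because \<open>enn2real\<close> sends infinity to 0.\<close>

lemma hoelder_norm_bounds:
  fixes f :: "'a::metric_space \<Rightarrow> 'b::real_normed_vector"
  assumes fin: "hoelder_norm \<alpha> U f < \<infinity>" and x: "x \<in> U"
  shows "norm (f x) \<le> enn2real (hoelder_norm \<alpha> U f)"
    and "y \<in> U \<Longrightarrow> norm (f x - f y) \<le> enn2real (hoelder_norm \<alpha> U f) * dist x y powr \<alpha>"
proof -
  let ?P = "{(x, y). x \<in> U \<and> y \<in> U \<and> x \<noteq> y}"
  have le: "t \<le> enn2real (hoelder_norm \<alpha> U f)" if "ennreal t \<le> hoelder_norm \<alpha> U f" for t
  proof (cases "t \<ge> 0")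
    case True
    with enn2real_mono[OF that] fin show ?thesis by (simp add: top.not_eq_extremum)
  next
    case False
    then show ?thesis using enn2real_nonneg[of "hoelder_norm \<alpha> U f"] by linarith
  qed
  have "ennreal (norm (f x)) \<le> hoelder_norm \<alpha> U f"
    unfolding hoelder_norm_def using x by (intro add_increasing2 SUP_upper) auto
  then show "norm (f x) \<le> enn2real (hoelder_norm \<alpha> U f)" by (rule le)
  assume y: "y \<in> U"
  show "norm (f x - f y) \<le> enn2real (hoelder_norm \<alpha> U f) * dist x y powr \<alpha>"
  proof (cases "x = y")
    case False
    with x y have "(\<lambda>(x, y). ennreal (norm (f x - f y) / dist x y powr \<alpha>)) (x, y) \<le>
        (SUP p\<in>?P. (\<lambda>(x, y). ennreal (norm (f x - f y) / dist x y powr \<alpha>)) p)"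
      by (intro SUP_upper) auto
    then have "ennreal (norm (f x - f y) / dist x y powr \<alpha>) \<le> hoelder_norm \<alpha> U f"
      unfolding hoelder_norm_def by (intro add_increasing) auto
    from le[OF this] False show ?thesis by (simp add: divide_le_eq)
  qed simp
qed

lemma hoelder_norm_diff_finite:
  assumes "f \<in> hoelder_space \<alpha> U V" "g \<in> hoelder_space \<alpha> U V"
  shows "hoelder_norm \<alpha> U (\<lambda>x. f x - g x) < \<infinity>"
proof -
  have "hoelder_norm \<alpha> U (\<lambda>x. - g x) = hoelder_norm \<alpha> U g"
    by (rule hoelder_norm_cong) (auto simp: norm_minus_commute)
  then have "hoelder_norm \<alpha> U (\<lambda>x. f x - g x) \<le> hoelder_norm \<alpha> U f + hoelder_norm \<alpha> U g"
    using hoelder_norm_triangle[of \<alpha> U f "\<lambda>x. - g x"] by simp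
  also have "\<dots> < \<infinity>" using assms by (auto simp: hoelder_space_def)
  finally show ?thesis .
qed

lemma hoelder_dist_bounds:
  assumes "f \<in> hoelder_space \<alpha> U V" "g \<in> hoelder_space \<alpha> U V" "x \<in> U"
  shows "norm (f x - g x) \<le> hoelder_dist \<alpha> U f g"
    and "y \<in> U \<Longrightarrow> norm ((f x - g x) - (f y - g y)) \<le> hoelder_dist \<alpha> U f g * dist x y powr \<alpha>"
  using hoelder_norm_bounds[OF hoelder_norm_diff_finite[OF assms(1,2)] assms(3)]
  unfolding hoelder_dist_def by blast+

lemma hoelder_dist_le:
  fixes f g :: "'a::metric_space \<Rightarrow> 'b::real_normed_vector"
  assumes "0 \<le> M" "0 \<le> K"
    and "\<And>x. x \<in> U \<Longrightarrow> norm (f x - g x) \<le> M"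
    and "\<And>x y. x \<in> U \<Longrightarrow> y \<in> U \<Longrightarrow> x \<noteq> y \<Longrightarrow>
      norm ((f x - g x) - (f y - g y)) \<le> K * dist x y powr \<alpha>"
  shows "hoelder_dist \<alpha> U f g \<le> M + K"
  using enn2real_mono[OF hoelder_norm_le[of M K U "\<lambda>x. f x - g x" \<alpha>]] assms
  by (simp add: hoelder_dist_def del: ennreal_plus)

lemma continuous_map_hoelder_iff:
  "continuous_map (hoelder_topology \<alpha> U V) (hoelder_topology \<beta> U' V') F \<longleftrightarrow>
    F \<in> hoelder_space \<alpha> U V \<rightarrow> hoelder_space \<beta> U' V' \<and>
    (\<forall>f\<in>hoelder_space \<alpha> U V. \<forall>\<epsilon>>0. \<exists>\<delta>>0. \<forall>g\<in>hoelder_space \<alpha> U V.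
      hoelder_dist \<alpha> U f g < \<delta> \<longrightarrow> hoelder_dist \<beta> U' (F f) (F g) < \<epsilon>)"
  unfolding hoelder_topology_def
  by (simp add: Metric_space.metric_continuous_map[OF Metric_space_hoelder Metric_space_hoelder]
      image_subset_iff_funcset Ball_def imp_conjL)

section \<open>Superposition with a Lipschitz map\<close>

text \<open>A bounded Lipschitz function is Hoelder for every exponent up to 1, by interpolation.
  The case \<alpha> = 1 is included for the sake of the Lipschitz target.\<close>

lemma superposition_in_hoelder_space:
  fixes \<Phi> :: "'b::real_normed_vector \<Rightarrow> 'c::real_normed_vector"
  assumes lip: "C-lipschitz_on V \<Phi>" and \<alpha>: "0 < \<alpha>" "\<alpha> \<le> 1"
    and W: "\<Phi> ` V \<subseteq> W" and f: "f \<in> hoelder_space 1 U V"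
  shows "restrict (\<Phi> \<circ> f) U \<in> hoelder_space \<alpha> U W"
proof -
  have C: "C \<ge> 0" using lip by (rule lipschitz_on_nonneg)
  have fV: "f x \<in> V" if "x \<in> U" for x using f that by (auto simp: hoelder_space_def)
  obtain g where g: "continuous_on (closure U) g" "g \<in> closure U \<rightarrow> V" "\<forall>x\<in>U. g x = f x"
    using f by (auto simp: hoelder_space_def)
  \<comment> \<open>\<Phi> is controlled on \<open>V\<close> only, so it matters that the extension
    \<open>g\<close> takes its values there.\<close>
  have "continuous_on (closure U) (\<Phi> \<circ> g)"
    using g(1,2) by (intro continuous_on_compose continuous_on_subset[OF lipschitz_on_continuous_on[OF lip]]) auto
  moreover have "hoelder_norm \<alpha> U (restrict (\<Phi> \<circ> f) U) < \<infinity>"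
  \<comment> \<open>\<open>V\<close> need not contain 0, so sizes are measured from the value at a
    base point of \<open>U\<close>.\<close>
  proof (cases "U = {}")
    case True
    then show ?thesis by (simp add: hoelder_norm_def bot_ennreal)
  next
    case False
    then obtain x0 where x0: "x0 \<in> U" by blast
    define N where "N = enn2real (hoelder_norm 1 U f)"
    have fin: "hoelder_norm 1 U f < \<infinity>" using f by (simp add: hoelder_space_def)
    have N: "norm (f x) \<le> N" "y \<in> U \<Longrightarrow> norm (f x - f y) \<le> N * dist x y" if "x \<in> U" for x y
      using hoelder_norm_bounds[OF fin that] by (auto simp: N_def)
    have "N \<ge> 0" by (simp add: N_def)
    have lip': "norm (\<Phi> (f x) - \<Phi> (f y)) \<le> C * norm (f x - f y)" if "x \<in> U" "y \<in> U" for x y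
      using lipschitz_onD[OF lip fV[OF that(1)] fV[OF that(2)]] by (simp add: dist_norm)
    \<comment> \<open>The summand 1 keeps \<open>M\<close> positive: for \<alpha> = 1 the factor
      \<open>M powr 0\<close> has to be 1, whereas \<open>0 powr 0\<close> is 0.\<close>
    define M where "M = C * (2 * N) + 1"
    have M: "M > 0" using C \<open>N \<ge> 0\<close> by (simp add: M_def add_nonneg_pos)
    have diff: "norm (\<Phi> (f x) - \<Phi> (f y)) \<le> M" if "x \<in> U" "y \<in> U" for x y
    proof -
      have "norm (f x - f y) \<le> 2 * N"
        using norm_triangle_ineq4[of "f x" "f y"] N(1)[OF that(1)] N(1)[OF that(2)] by simp
      with C have "C * norm (f x - f y) \<le> C * (2 * N)" by (rule mult_left_mono[rotated])
      with lip'[OF that] show ?thesis by (simp add: M_def)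
    qed
    have "hoelder_norm \<alpha> U (restrict (\<Phi> \<circ> f) U)
        \<le> ennreal ((norm (\<Phi> (f x0)) + M) + M powr (1 - \<alpha>) * (C * N) powr \<alpha>)"
    proof (rule hoelder_norm_le)
      fix x assume "x \<in> U"
      then show "norm (restrict (\<Phi> \<circ> f) U x) \<le> norm (\<Phi> (f x0)) + M"
        using norm_triangle_ineq2[of "\<Phi> (f x)" "\<Phi> (f x0)"] diff[OF _ x0, of x] by simp
    next
      fix x y assume xy: "x \<in> U" "y \<in> U"
      have "norm (\<Phi> (f x) - \<Phi> (f y)) \<le> C * (N * dist x y)"
        using lip'[OF xy] mult_left_mono[OF N(2)[OF xy] C] by linarith
      then have "norm (\<Phi> (f x) - \<Phi> (f y)) \<le> M powr (1 - \<alpha>) * (C * N * dist x y) powr \<alpha>"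
        using diff[OF xy] M \<alpha> by (intro interpolate_powr) (auto simp: mult.assoc)
      also have "\<dots> = M powr (1 - \<alpha>) * (C * N) powr \<alpha> * dist x y powr \<alpha>"
        using C \<open>N \<ge> 0\<close> by (simp add: powr_mult)
      finally show "norm (restrict (\<Phi> \<circ> f) U x - restrict (\<Phi> \<circ> f) U y)
          \<le> M powr (1 - \<alpha>) * (C * N) powr \<alpha> * dist x y powr \<alpha>"
        using xy by simp
    qed (use M in auto)
    then show ?thesis by (rule order.strict_trans1) simp
  qed
  ultimately show ?thesis
    unfolding hoelder_space_def
  proof (intro CollectI conjI exI[of _ "\<Phi> \<circ> g"])
    show "restrict (\<Phi> \<circ> f) U \<in> U \<rightarrow>\<^sub>E W" using W fV by auto
    show "\<Phi> \<circ> g \<in> closure U \<rightarrow> W" using W g(2) by (simp add: Pi_iff image_subset_iff)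
    show "\<forall>x\<in>U. (\<Phi> \<circ> g) x = restrict (\<Phi> \<circ> f) U x" using g(3) by simp
  qed
qed

text \<open>The image of a convergent sequence converges uniformly and is bounded in the Lipschitz norm;
  interpolating between these two bounds gives convergence for every exponent below 1.\<close>

lemma superposition_continuous:
  fixes \<Phi> :: "'b::real_normed_vector \<Rightarrow> 'c::real_normed_vector"
  assumes lip: "C-lipschitz_on V \<Phi>" and \<alpha>: "0 < \<alpha>" "\<alpha> < 1" and W: "\<Phi> ` V \<subseteq> W"
  shows "continuous_map (hoelder_topology 1 U V) (hoelder_topology \<alpha> U W) (\<lambda>f. restrict (\<Phi> \<circ> f) U)"
  unfolding continuous_map_hoelder_iff
proof (intro conjI ballI allI impI funcsetI)
  fix f assume "f \<in> hoelder_space 1 U V"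
  then show "restrict (\<Phi> \<circ> f) U \<in> hoelder_space \<alpha> U W"
    by (rule superposition_in_hoelder_space[OF lip \<alpha>(1) less_imp_le[OF \<alpha>(2)] W])
next
  fix f and \<epsilon> :: real
  assume f: "f \<in> hoelder_space 1 U V" and "\<epsilon> > 0"
  have C: "C \<ge> 0" using lip by (rule lipschitz_on_nonneg)
  define N where "N = enn2real (hoelder_norm 1 U f)"
  have "N \<ge> 0" by (simp add: N_def)
  \<comment> \<open>\<open>N\<close> is a Lipschitz constant of \<open>f\<close>, and N + 1 one of
    every \<open>g\<close> at distance below 1 from it; \<open>K\<close> is C times their
    sum.\<close>
  define K where "K = C * (2 * N + 1)"
  have "K \<ge> 0" using C \<open>N \<ge> 0\<close> by (simp add: K_def)
  \<comment> \<open>\<open>h t\<close> will bound the distance of the images of functions less than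
    t apart: first the uniform part, then the interpolated seminorm, where the extra t makes the
    base positive.\<close>
  define h where "h t = C * t + (2 * C * t + t) powr (1 - \<alpha>) * K powr \<alpha>" for t
  have nonneg: "eventually (\<lambda>t. 0 \<le> 2 * C * t + t) (at_right 0)"
    by (rule eventually_mono[OF eventually_at_right_less[of 0]]) (use C in simp)
  have lim: "((\<lambda>t. 2 * C * t + t) \<longlongrightarrow> 2 * C * 0 + 0) (at_right 0)"
    by (intro tendsto_intros)
  \<comment> \<open>The base tends to 0, so a positive exponent is essential; here \<alpha> < 1 is
    decisive.\<close>
  have "((\<lambda>t. (2 * C * t + t) powr (1 - \<alpha>)) \<longlongrightarrow> (2 * C * 0 + 0) powr (1 - \<alpha>)) (at_right 0)"
    by (rule tendsto_powr'[OF lim tendsto_const]) (use \<alpha> nonneg in \<open>intro disjI2 conjI, simp_all\<close>)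
  then have "(h \<longlongrightarrow> C * 0 + (2 * C * 0 + 0) powr (1 - \<alpha>) * K powr \<alpha>) (at_right 0)"
    unfolding h_def by (intro tendsto_add tendsto_mult tendsto_const tendsto_ident_at)
  then have "eventually (\<lambda>t. h t < \<epsilon>) (at_right 0)"
    using \<open>\<epsilon> > 0\<close> by (intro order_tendstoD(2)) auto
  then obtain b where b: "b > 0" "\<And>t. 0 < t \<Longrightarrow> t < b \<Longrightarrow> h t < \<epsilon>"
    by (auto simp: eventually_at_right_field)
  define \<delta> where "\<delta> = min (b / 2) 1"
  have \<delta>: "\<delta> > 0" "\<delta> \<le> 1" "h \<delta> < \<epsilon>" using b by (auto simp: \<delta>_def)
  have "hoelder_dist \<alpha> U (restrict (\<Phi> \<circ> f) U) (restrict (\<Phi> \<circ> g) U) < \<epsilon>"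
    if g: "g \<in> hoelder_space 1 U V" and close: "hoelder_dist 1 U f g < \<delta>" for g
  proof -
    have V: "f x \<in> V" "g x \<in> V" if "x \<in> U" for x using f g that by (auto simp: hoelder_space_def)
    have fg: "norm (f x - g x) \<le> \<delta>" if "x \<in> U" for x
      using hoelder_dist_bounds(1)[OF f g that] close by simp
    have fin: "hoelder_norm 1 U f < \<infinity>" using f by (simp add: hoelder_space_def)
    have fN: "norm (f x - f y) \<le> N * dist x y" if "x \<in> U" "y \<in> U" for x y
      using hoelder_norm_bounds(2)[OF fin that] by (simp add: N_def)
    have gN: "norm (g x - g y) \<le> (N + 1) * dist x y" if "x \<in> U" "y \<in> U" for x y
    proof -
      have "norm ((f x - g x) - (f y - g y)) \<le> 1 * dist x y"
        using hoelder_dist_bounds(2)[OF f g that] close \<delta>(2)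
          mult_right_mono[of "hoelder_dist 1 U f g" 1 "dist x y"] by simp
      moreover have "g x - g y = (f x - f y) - ((f x - g x) - (f y - g y))" by simp
      ultimately show ?thesis
        using norm_triangle_ineq4[of "f x - f y" "(f x - g x) - (f y - g y)"] fN[OF that]
        by (simp add: algebra_simps)
    qed
    have lip': "norm (\<Phi> a - \<Phi> b) \<le> C * norm (a - b)" if "a \<in> V" "b \<in> V" for a b
      using lipschitz_onD[OF lip that] by (simp add: dist_norm)
    have small: "norm (\<Phi> (f x) - \<Phi> (g x)) \<le> C * \<delta>" if "x \<in> U" for x
      using lip'[of "f x" "g x"] V[OF that] mult_left_mono[OF fg[OF that] C] by simp
    have "hoelder_dist \<alpha> U (restrict (\<Phi> \<circ> f) U) (restrict (\<Phi> \<circ> g) U)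
        \<le> C * \<delta> + (2 * C * \<delta> + \<delta>) powr (1 - \<alpha>) * K powr \<alpha>"
    proof (rule hoelder_dist_le)
      fix x y assume xy: "x \<in> U" "y \<in> U"
      let ?d = "(\<Phi> (f x) - \<Phi> (g x)) - (\<Phi> (f y) - \<Phi> (g y))"
      have "norm ?d \<le> 2 * C * \<delta> + \<delta>"
        using norm_triangle_ineq4[of "\<Phi> (f x) - \<Phi> (g x)" "\<Phi> (f y) - \<Phi> (g y)"]
          small[OF xy(1)] small[OF xy(2)] \<delta>(1) by simp
      moreover have "norm ?d \<le> K * dist x y"
      proof -
        \<comment> \<open>The uniform bound paired the two functions at one point; this one pairs
          two points for each function, since a nonlinear \<Phi> gives no direct control of the
          mixed difference.\<close>
        have "?d = (\<Phi> (f x) - \<Phi> (f y)) - (\<Phi> (g x) - \<Phi> (g y))" by simp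
        then have "norm ?d \<le> norm (\<Phi> (f x) - \<Phi> (f y)) + norm (\<Phi> (g x) - \<Phi> (g y))"
          by (metis norm_triangle_ineq4)
        also have "\<dots> \<le> C * (N * dist x y) + C * ((N + 1) * dist x y)"
          by (intro add_mono order.trans[OF lip'] mult_left_mono fN gN V xy C)
        also have "\<dots> = K * dist x y" by (simp add: K_def algebra_simps)
        finally show ?thesis .
      qed
      ultimately have "norm ?d \<le> (2 * C * \<delta> + \<delta>) powr (1 - \<alpha>) * (K * dist x y) powr \<alpha>"
        using \<alpha> C \<delta>(1) by (intro interpolate_powr) (auto intro: add_nonneg_pos)
      also have "\<dots> = (2 * C * \<delta> + \<delta>) powr (1 - \<alpha>) * K powr \<alpha> * dist x y powr \<alpha>"
        using \<open>K \<ge> 0\<close> by (simp add: powr_mult)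
      finally show "norm ((restrict (\<Phi> \<circ> f) U x - restrict (\<Phi> \<circ> g) U x) -
            (restrict (\<Phi> \<circ> f) U y - restrict (\<Phi> \<circ> g) U y))
          \<le> (2 * C * \<delta> + \<delta>) powr (1 - \<alpha>) * K powr \<alpha> * dist x y powr \<alpha>"
        using xy by simp
    qed (use C \<delta> small in auto)
    also have "\<dots> < \<epsilon>" using \<delta>(3) by (simp add: h_def)
    finally show ?thesis .
  qed
  with \<delta>(1) show "\<exists>\<delta>>0. \<forall>g\<in>hoelder_space 1 U V. hoelder_dist 1 U f g < \<delta> \<longrightarrow>
      hoelder_dist \<alpha> U (restrict (\<Phi> \<circ> f) U) (restrict (\<Phi> \<circ> g) U) < \<epsilon>" by blast
qed

section \<open>The Lipschitz case\<close>

text \<open>A multiple of a coordinate projection: linear and isometric in t, yet for d >= 2 its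
  eigenvalues t and 0 cross at t = 0, which produces the kink.\<close>

definition corner :: "'d \<Rightarrow> real \<Rightarrow> complex^'d^'d" where
  "corner k t = (\<chi> i j. if i = k \<and> j = k then of_real t else 0)"

lemma corner_in_Herm: "corner k t \<in> Herm"
  by (simp add: Herm_def conj_transpose_def corner_def vec_eq_iff)

lemma corner_diff: "corner k s - corner k t = corner k (s - t)"
  by (simp add: corner_def vec_eq_iff)

lemma norm_corner: "norm (corner k t :: complex^'d^'d) = \<bar>t\<bar>"
proof -
  have "corner k t = axis k (axis k (complex_of_real t))"
    by (simp add: corner_def vec_eq_iff axis_def)
  then show ?thesis by (simp add: norm_eq_sqrt_inner inner_axis_axis inner_complex_def)
qed

lemma last_sorted_list_of_multiset:
  assumes "M \<noteq> {#}"
  shows "sorted_list_of_multiset M ! (size M - 1) = Max (set_mset M)"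
proof -
  let ?xs = "sorted_list_of_multiset M"
  have len: "length ?xs = size M" by (metis mset_sorted_list_of_multiset size_mset)
  have "size M - 1 < size M" using assms by (simp add: nonempty_has_size)
  have "?xs ! (size M - 1) \<in> set_mset M"
    using nth_mem[of "size M - 1" ?xs] \<open>size M - 1 < size M\<close> by (simp add: len)
  moreover have "x \<le> ?xs ! (size M - 1)" if "x \<in># M" for x
  proof -
    from that obtain j where "j < size M" "?xs ! j = x"
      by (metis in_set_conv_nth len set_sorted_list_of_multiset)
    then show ?thesis
      using sorted_nth_mono[of ?xs j "size M - 1"] by (simp add: len) 
  qed
  ultimately show ?thesis by (metis Max_eqI finite_set_mset)
qed

text \<open>The eigenvalue 0 occurs beside t as soon as d >= 2; for d = 1 the value would be t
  itself, without a kink.\<close>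

lemma lambda_up_corner_top:
  fixes k :: "'d::{finite,linorder}"
  assumes "CARD('d) \<ge> 2"
  shows "lambda_up (corner k t :: complex^('d::{finite,linorder})^('d::{finite,linorder})) $ Max UNIV = max t 0"
proof -
  define \<mu> where "\<mu> = (\<lambda>i. if i = k then t else 0)"
  have Re_corner: "Re (corner k t $ i $ i) = \<mu> i" for i
    by (simp add: corner_def \<mu>_def)
  have "charpoly (corner k t :: complex^('d::{finite,linorder})^('d::{finite,linorder})) =
      (\<Prod>i\<in>UNIV. [:- corner k t $ i $ i, 1:])"
    by (rule charpoly_diagonal) (auto simp: corner_def)
  then have "proots (charpoly (corner k t :: complex^('d::{finite,linorder})^('d::{finite,linorder}))) =
      image_mset (\<lambda>i. corner k t $ i $ i) (mset_set UNIV)"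
    by (simp add: proots_prod_linear_factors)
  then have ev: "increasing_eigenvalues (corner k t :: complex^('d::{finite,linorder})^('d::{finite,linorder})) =
      sorted_list_of_multiset (image_mset \<mu> (mset_set UNIV))"
    by (simp add: increasing_eigenvalues_def image_mset.compositionality comp_def Re_corner)
  \<comment> \<open>All d - 1 other indices lie below \<open>Max UNIV\<close>, so it picks the last
    entry of the sorted list.\<close>
  have "j < Max UNIV \<longleftrightarrow> j \<noteq> Max UNIV" for j :: 'd
    using Max_ge[OF finite UNIV_I, of j] by (simp only: order_less_le simp_thms)
  then have "{j. j < Max (UNIV :: 'd set)} = UNIV - {Max UNIV}"
    by blast
  then have "card {j. j < Max (UNIV :: 'd set)} = CARD('d) - 1"
    by (simp add: card_Diff_singleton)
  then have "lambda_up (corner k t :: complex^('d::{finite,linorder})^('d::{finite,linorder})) $ Max UNIV =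
      Max (range \<mu>)"
    using last_sorted_list_of_multiset[of "image_mset \<mu> (mset_set UNIV)"]
    by (simp add: lambda_up_def ev mset_set_empty_iff)
  also have "range \<mu> = {t, 0}"
  proof -
    have "(UNIV :: 'd set) \<noteq> {k}"
    proof
      assume "(UNIV :: 'd set) = {k}"
      then have "CARD('d) = card {k}" by (rule arg_cong)
      with assms show False by simp
    qed
    then obtain i where "i \<noteq> k" by blast
    then have "\<mu> i = 0" "\<mu> k = t" by (simp_all add: \<mu>_def)
    moreover have "range \<mu> \<subseteq> {t, 0}" by (auto simp: \<mu>_def)
    ultimately show ?thesis by (metis insert_subset empty_subsetI rangeI subset_antisym)
  qed
  finally show ?thesis by simp
qed

text \<open>With \<open>s\<close> an affine coordinate vanishing at \<open>p\<close>, the largest eigenvalue of \<open>corner k s\<close> is the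
  positive part of \<open>s\<close>. Shifting by \<open>h\<close> moves the kink of the positive part, so that on the segment
  from \<open>p - h e\<close> to \<open>p\<close> the difference of the eigenvalues has slope 1, however small \<open>h\<close> is.\<close>

lemma characteristic_map_not_continuous:
  fixes U :: "'a::euclidean_space set"
  assumes "bounded U" "open U" "U \<noteq> {}" and d: "CARD('d::{finite,linorder}) \<ge> 2"
  shows "\<not> continuous_map (hoelder_topology 1 U (Herm :: (complex^('d::{finite,linorder})^('d::{finite,linorder})) set))
    (hoelder_topology 1 U UNIV) (characteristic_map U)"
proof
  let ?H = "Herm :: (complex^('d::{finite,linorder})^('d::{finite,linorder})) set"
  let ?S = "hoelder_space 1 U ?H" and ?T = "hoelder_space 1 U (UNIV :: (real^('d::{finite,linorder})) set)"
  assume "continuous_map (hoelder_topology 1 U ?H) (hoelder_topology 1 U UNIV) (characteristic_map U)"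
  note * = this[unfolded continuous_map_hoelder_iff]
  have cm: "characteristic_map U \<in> ?S \<rightarrow> ?T"
    using * by (rule conjunct1)
  have cont: "\<forall>\<epsilon>>0. \<exists>\<delta>>0. \<forall>g\<in>?S. hoelder_dist 1 U f g < \<delta> \<longrightarrow>
      hoelder_dist 1 U (characteristic_map U f) (characteristic_map U g) < \<epsilon>" if "f \<in> ?S" for f
    using *[THEN conjunct2] that by (rule bspec)
  obtain p where p: "p \<in> U" using assms by blast
  obtain e :: 'a where "e \<in> Basis" using nonempty_Basis by blast
  then have e: "norm e = 1" by simp
  obtain r where r: "r > 0" "ball p r \<subseteq> U" using assms(2) p openE by blast
  obtain R where R: "\<And>x. x \<in> U \<Longrightarrow> norm (x - p) \<le> R" "R > 0"
    using bounded_translation_minus[OF assms(1), of p] unfolding bounded_pos by blast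
  obtain k :: 'd where True by blast
  define F where "F h = restrict (\<lambda>x. corner k ((x - p) \<bullet> e + h)) U" for h
  have F: "F h \<in> ?S" for h
  proof -
    let ?g = "\<lambda>x. corner k ((x - p) \<bullet> e + h) :: complex^('d::{finite,linorder})^('d::{finite,linorder})"
    have lip: "norm (?g x - ?g y) \<le> 1 * dist x y powr 1" for x y
    proof -
      have "((x - p) \<bullet> e + h) - ((y - p) \<bullet> e + h) = (x - y) \<bullet> e"
        by (simp add: inner_diff_left)
      then have "norm (?g x - ?g y) = \<bar>(x - y) \<bullet> e\<bar>"
        by (simp only: corner_diff norm_corner)
      then show ?thesis
        using Cauchy_Schwarz_ineq2[of "x - y" e] by (simp add: e dist_norm)
    qed
    have "continuous_on (closure U) ?g"
      by (rule lipschitz_on_continuous_on[OF lipschitz_onI[where L = 1]])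
        (use lip in \<open>simp_all add: dist_norm\<close>)
    moreover have "hoelder_norm 1 U (F h) \<le> ennreal ((R + \<bar>h\<bar>) + 1)"
    proof (rule hoelder_norm_le)
      fix x assume x: "x \<in> U"
      have "\<bar>(x - p) \<bullet> e\<bar> \<le> R"
        using Cauchy_Schwarz_ineq2[of "x - p" e] R(1)[OF x] e by simp
      with x show "norm (F h x) \<le> R + \<bar>h\<bar>" by (simp add: F_def norm_corner)
    next
      fix x y assume "x \<in> U" "y \<in> U"
      then show "norm (F h x - F h y) \<le> 1 * dist x y powr 1"
        using lip[of x y] by (simp only: F_def restrict_apply')
    qed (use R(2) in simp_all)
    then have "hoelder_norm 1 U (F h) < \<infinity>" by (rule order.strict_trans1) simp
    ultimately show ?thesis
      unfolding hoelder_space_def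
    proof (intro CollectI conjI exI[of _ ?g])
      show "F h \<in> U \<rightarrow>\<^sub>E Herm" unfolding F_def by (intro restrict_PiE_iff[THEN iffD2] ballI corner_in_Herm)
    qed (simp_all add: F_def corner_in_Herm)
  qed
  obtain \<delta> where \<delta>: "\<delta> > 0"
    "\<And>g. g \<in> ?S \<Longrightarrow> hoelder_dist 1 U (F 0) g < \<delta> \<Longrightarrow>
      hoelder_dist 1 U (characteristic_map U (F 0)) (characteristic_map U g) < 1"
    using cont[OF F[of 0], rule_format, OF zero_less_one] by blast
  \<comment> \<open>The bound by r keeps the point p - h e in \<open>U\<close>; the bound by
    \<delta> makes \<open>F h\<close> close enough to \<open>F 0\<close>.\<close>
  define h where "h = min (r / 2) (\<delta> / 2)"
  have h: "h > 0" "h < r" "h < \<delta>" using r \<delta>(1) by (auto simp: h_def)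
  \<comment> \<open>The two families differ by a constant matrix of norm h, which has seminorm
    0.\<close>
  have "hoelder_dist 1 U (F 0) (F h) \<le> h + 0"
    using h by (intro hoelder_dist_le) (simp_all add: F_def corner_diff norm_corner)
  then have less: "hoelder_dist 1 U (characteristic_map U (F 0)) (characteristic_map U (F h)) < 1"
    using \<delta>(2)[OF F[of h]] h by simp
  define q where "q = p - h *\<^sub>R e"
  have q: "q \<in> U" "dist p q = h"
  proof -
    show "dist p q = h" using h e by (simp add: q_def dist_norm)
    with h have "q \<in> ball p r" by simp
    then show "q \<in> U" using r(2) by (rule subsetD[rotated])
  qed
  have qe: "(q - p) \<bullet> e = - h" using e by (simp add: q_def dot_square_norm)
  let ?\<Lambda> = "\<lambda>h x. characteristic_map U (F h) x"
  have top: "?\<Lambda> a x $ Max UNIV = max ((x - p) \<bullet> e + a) 0" if "x \<in> U" for a x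
    using that lambda_up_corner_top[OF d] by (simp add: characteristic_map_def F_def)
  let ?v = "(?\<Lambda> 0 p - ?\<Lambda> h p) - (?\<Lambda> 0 q - ?\<Lambda> h q)"
  \<comment> \<open>At \<open>q\<close> both positive parts vanish, their arguments being -h and 0;
    at \<open>p\<close> they are 0 and h.\<close>
  have "?v $ Max UNIV = - h"
    using p q qe h by (simp add: top)
  then have "h \<le> norm ?v"
    using component_le_norm_cart[of ?v "Max UNIV"] h by simp
  also have "\<dots> \<le> hoelder_dist 1 U (characteristic_map U (F 0)) (characteristic_map U (F h)) * dist p q powr 1"
    by (rule hoelder_dist_bounds(2)[OF funcset_mem[OF cm F] funcset_mem[OF cm F] p q(1)])
  also have "\<dots> < h"
    using less h q by simp
  finally show False by simp
qed

text \<open>The middle conjunct ensures that what fails for exponent 1 is continuity and not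
  membership in the target. The guards on the failure exclude cases where the map is continuous: for
  empty \<open>U\<close> the source is a single point, and for d = 1 the eigenvalue is a linear
  function of the matrix.\<close>

theorem corollary1p6:
  fixes U :: "(real^'m) set"
    and H :: "(complex^('d::{finite,linorder})^('d::{finite,linorder})) set"
    and V :: "(real^('d::{finite,linorder})) set"
  assumes "bounded U" and "lipschitz_domain U"
  defines "H \<equiv> Herm" and "V \<equiv> UNIV"
  shows "(\<forall>\<alpha>. 0 < \<alpha> \<and> \<alpha> < 1 \<longrightarrow>
            continuous_map (hoelder_topology 1 U H) (hoelder_topology \<alpha> U V) (characteristic_map U)) \<and>
         characteristic_map U \<in> hoelder_space 1 U H \<rightarrow> hoelder_space 1 U V \<and>
         (U \<noteq> {} \<and> CARD('d) \<ge> 2 \<longrightarrow>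
            \<not> continuous_map (hoelder_topology 1 U H) (hoelder_topology 1 U V) (characteristic_map U))"
proof -
  have lip: "CARD('d)-lipschitz_on H lambda_up"
    unfolding H_def using lambda_up_lipschitz by (intro lipschitz_onI) (auto simp: dist_norm)
  have cm: "characteristic_map U =
      (\<lambda>A :: real^'m \<Rightarrow> complex^('d::{finite,linorder})^('d::{finite,linorder}). restrict (lambda_up \<circ> A) U)"
    by (simp add: characteristic_map_def fun_eq_iff)
  have "continuous_map (hoelder_topology 1 U H) (hoelder_topology \<alpha> U V) (characteristic_map U)"
    if "0 < \<alpha>" "\<alpha> < 1" for \<alpha>
    unfolding cm using that by (intro superposition_continuous[OF lip]) (auto simp: V_def)
  moreover have "characteristic_map U \<in> hoelder_space 1 U H \<rightarrow> hoelder_space 1 U V"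
    unfolding cm by (intro funcsetI superposition_in_hoelder_space[OF lip]) (auto simp: V_def)
  moreover have "open U" using assms(2) by (simp add: lipschitz_domain_def)
  ultimately show ?thesis
    using characteristic_map_not_continuous[where 'd = 'd, OF \<open>bounded U\<close> \<open>open U\<close>]
    unfolding H_def V_def by simp
qed

end
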